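(* Let $k\ge 2$ and $i\in\{1,\dots,k\}$. Then \[ \frac{\prod_{m\ge 1}(1-q^{2km})(1-q^{2km-k+i-1})(1-q^{2km-k-i+1})}{\prod_{m\ge1}(1-q^m)}=\sum_{n\ge 0}b_{k,i}(n)q^n, \] where $b_{k,i}(n)$ is the number of partitions $\pi=(\pi_1,\dots,\pi_{\ell(\pi)})$ of $n$ such that: (1) $\pi_t-\pi_{t+k-1}\ge 2$ for all $t$ with $t+k-1\le\ell(\pi)$; (2) $m_1(\pi)\le k-i$; (3) for all $t$ with $t+k-2\le\ell(\pi)$, $\pi_t-\pi_{t+k-2}\le 1$ only if $\pi_t+\pi_{t+1}+\cdots+\pi_{t+k-2}\equiv i+k\pmod 2$.
   Context: $q$ is a formal variable and the identity is one of formal power series. A partition of $n$ is a nonincreasing finite sequence $\pi_1\ge\cdots\ge\pi_{\ell(\pi)}$ of positive integers summing to $n$ (the empty partition counts for $n=0$); $m_1(\pi)$ is the number of parts equal to $1$. *)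

theory Defs
  imports
    "HOL-Analysis.Infinite_Products"
    "HOL-Computational_Algebra.Formal_Power_Series"
    "HOL-Number_Theory.Cong"
begin

definition is_partition :: "nat \<Rightarrow> nat list \<Rightarrow> bool" where
  "is_partition n p \<longleftrightarrow> sorted_wrt (\<ge>) p \<and> (\<forall>x \<in> set p. x > 0) \<and> sum_list p = n"

(* List positions start at 0, so the part pi_t is p ! (t - 1): the mathematical range
   1 <= t, t + k - 1 <= l(pi) is t + k - 1 < length p here, and likewise for k - 2.
   As p is nonincreasing, the subtractions of parts never truncate. *)
definition bressoud_partitions :: "nat \<Rightarrow> nat \<Rightarrow> nat \<Rightarrow> nat list set" where
  "bressoud_partitions k i n = {p. is_partition n p \<and>
     (\<forall>t. t + k - 1 < length p \<longrightarrow> p ! t - p ! (t + k - 1) \<ge> 2) \<and>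
     count_list p 1 \<le> k - i \<and>
     (\<forall>t. t + k - 2 < length p \<longrightarrow> p ! t - p ! (t + k - 2) \<le> 1 \<longrightarrow>
        [(\<Sum>j = t..t + k - 2. p ! j) = i + k] (mod 2))}"

definition b :: "nat \<Rightarrow> nat \<Rightarrow> nat \<Rightarrow> nat" where
  "b k i n = card (bressoud_partitions k i n)"

end

(* Write K = k - 1, and let C_s(N) be the generating function of the partitions with all parts
   > N that satisfy the gap condition, contain N + 1 at most s times and satisfy the parity
   condition with residue s + N K. Removing the parts N + 1 gives
     C_s(N) = C_(s-2)(N) + q^((N+1)(s-1)) (1 + q^(N+1)) C_(K-s)(N+1)      (s >= 2),
   together with the degenerate forms for s = 0, 1, and C_s(N) = 1 + O(q^(N+1)).
   Bressoud's solution of this system, an Andrews J function specialised to x = q^N, becomes after multiplication by (q;q)_infinity (-q;q)_N the series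
     sum_n (-1)^n q^(n(NK + kn + k - r)) (1 - q^(r(N+2n+1))) prod_(j=1..N) (1 - q^(2(n+j))),
   r = s + 1, whose terms are polynomials and whose recurrences hold by telescoping. Modulo q^M
   the system is solved by downward induction from N = M. At N = 0 the series is the theta
   series of the product side, by the Jacobi triple product, which is obtained from the
   q-binomial theorem modulo q^M as well. *)
theory Submission
  imports Defs
begin

unbundle no vec_syntax
unbundle fps_syntax

subsection \<open>Congruences of formal power series\<close>

definition fps_cong :: "nat \<Rightarrow> 'a::comm_ring_1 fps \<Rightarrow> 'a fps \<Rightarrow> bool" where
  "fps_cong M f g \<longleftrightarrow> fps_X ^ M dvd f - g"

lemma fps_X_power_dvd_iff:
  "fps_X ^ M dvd (f :: 'a::comm_ring_1 fps) \<longleftrightarrow> (\<forall>n<M. f $ n = 0)"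
proof
  assume "fps_X ^ M dvd f"
  then show "\<forall>n<M. f $ n = 0"
    by (auto simp: dvd_def fps_X_power_mult_nth)
next
  assume *: "\<forall>n<M. f $ n = 0"
  have "f = fps_X ^ M * fps_shift M f"
    by (rule fps_ext) (use * in \<open>auto simp: fps_X_power_mult_nth\<close>)
  then show "fps_X ^ M dvd f"
    by (metis dvd_triv_left)
qed

lemma fps_cong_iff: "fps_cong M f g \<longleftrightarrow> (\<forall>n<M. f $ n = g $ n)"
  by (simp add: fps_cong_def fps_X_power_dvd_iff)

lemma fps_cong_refl [simp]: "fps_cong M f f"
  by (simp add: fps_cong_iff)

lemma fps_cong_sym: "fps_cong M f g \<Longrightarrow> fps_cong M g f"
  by (simp add: fps_cong_iff)

lemma fps_cong_trans [trans]: "fps_cong M f g \<Longrightarrow> fps_cong M g h \<Longrightarrow> fps_cong M f h"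
  by (simp add: fps_cong_iff)

lemma fps_cong_add: "fps_cong M f g \<Longrightarrow> fps_cong M f' g' \<Longrightarrow> fps_cong M (f + f') (g + g')"
  by (simp add: fps_cong_iff)

lemma fps_cong_diff: "fps_cong M f g \<Longrightarrow> fps_cong M f' g' \<Longrightarrow> fps_cong M (f - f') (g - g')"
  by (simp add: fps_cong_iff)

lemma fps_cong_mult: "fps_cong M f g \<Longrightarrow> fps_cong M f' g' \<Longrightarrow> fps_cong M (f * f') (g * g')"
  by (auto simp: fps_cong_iff fps_mult_nth intro!: sum.cong)

lemma fps_cong_sum: "(\<And>x. x \<in> A \<Longrightarrow> fps_cong M (f x) (g x)) \<Longrightarrow> fps_cong M (sum f A) (sum g A)"
  by (auto simp: fps_cong_iff fps_sum_nth)

lemma fps_cong_mono: "fps_cong M f g \<Longrightarrow> N \<le> M \<Longrightarrow> fps_cong N f g"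
  by (simp add: fps_cong_iff)

text \<open>A factor \<open>fps_X ^ e\<close> gains \<open>e\<close> orders of precision. In the
  triple product this makes up for q-binomial coefficients far from the centre, which are controlled
  only to low order.\<close>

lemma fps_cong_mult_X_power:
  "fps_cong M f g \<Longrightarrow> K \<le> e + M \<Longrightarrow> fps_cong K (fps_X ^ e * f) (fps_X ^ e * g)"
  by (auto simp: fps_cong_iff fps_X_power_mult_nth)

lemma fps_cong_cancel:
  fixes f g u :: "'a::field fps"
  assumes "fps_cong M (u * f) (u * g)" "u $ 0 \<noteq> 0"
  shows "fps_cong M f g"
proof -
  have "fps_cong M (inverse u * (u * f)) (inverse u * (u * g))"
    by (intro fps_cong_mult assms fps_cong_refl)
  then show ?thesis
    using assms(2) by (simp add: mult.assoc [symmetric] inverse_mult_eq_1)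
qed

lemma fps_cong_mult_X_power_0: "M \<le> e \<Longrightarrow> fps_cong M (f * fps_X ^ e * g) 0"
  by (auto simp: fps_cong_def intro: dvd_mult dvd_mult2 le_imp_power_dvd)

lemma fps_cong_one_minus_X_power: "M \<le> e \<Longrightarrow> fps_cong M (1 - fps_X ^ e) 1"
  by (simp add: fps_cong_iff)

section \<open>Products whose factors tend to 1\<close>

lemma fps_cong_prod_lessThan:
  fixes f :: "nat \<Rightarrow> 'a::comm_ring_1 fps"
  assumes "\<And>m. m \<ge> k \<Longrightarrow> fps_cong M (f m) 1" "k \<le> l"
  shows "fps_cong M (\<Prod>m<l. f m) (\<Prod>m<k. f m)"
  using assms(2)
proof (induction l rule: dec_induct)
  case (step n)
  have "fps_cong M ((\<Prod>m<n. f m) * f n) ((\<Prod>m<k. f m) * 1)"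
    using step assms(1)[of n] by (intro fps_cong_mult) auto
  then show ?case by simp
qed simp

lemma fps_eqI_cong: "(\<And>M. fps_cong M f g) \<Longrightarrow> f = g"
  by (rule fps_ext) (meson fps_cong_iff lessI)

text \<open>The coefficient of \<open>fps_X ^ n\<close> in the partial products is constant from
  \<open>Suc n\<close> factors on; \<open>P\<close> collects these stable values.\<close>

lemma fps_prodinf_cong:
  fixes f :: "nat \<Rightarrow> 'a::idom fps"
  assumes f: "\<And>m. fps_cong (Suc m) (f m) 1"
  shows "fps_cong M (prodinf f) (\<Prod>m<M. f m)" and "prodinf f $ 0 = 1"
proof -
  define P where "P = Abs_fps (\<lambda>n. (\<Prod>m<Suc n. f m) $ n)"
  have PM: "fps_cong M P (\<Prod>m<M. f m)" for M
    unfolding fps_cong_iff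
  proof safe
    fix n assume "n < M"
    then have "fps_cong (Suc n) (\<Prod>m<M. f m) (\<Prod>m<Suc n. f m)"
      by (intro fps_cong_prod_lessThan fps_cong_mono[OF f]) auto
    then show "P $ n = (\<Prod>m<M. f m) $ n"
      by (auto simp: fps_cong_iff P_def)
  qed
  have P0: "P $ 0 = 1"
    using f[of 0] by (simp add: P_def fps_cong_iff)
  have "(\<lambda>n. \<Prod>m\<le>n. f m) \<longlonglongrightarrow> P"
  proof (rule tendsto_fpsI)
    fix n
    have "(\<Prod>m\<le>N. f m) $ n = P $ n" if "N \<ge> n" for N
      using PM[of "Suc N"] that by (auto simp: fps_cong_iff lessThan_Suc_atMost)
    then show "\<forall>\<^sub>F N in sequentially. (\<Prod>m\<le>N. f m) $ n = P $ n"
      by (auto simp: eventually_sequentially)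
  qed
  \<comment> \<open>Convergence in the sense of \<open>has_prod\<close> requires a nonzero
    limit.\<close>
  moreover have "P \<noteq> 0"
    using P0 by auto
  ultimately have "f has_prod P"
    by (simp add: has_prod_def raw_has_prod_def)
  then have "prodinf f = P"
    by (metis has_prod_unique)
  then show "fps_cong M (prodinf f) (\<Prod>m<M. f m)" and "prodinf f $ 0 = 1"
    using PM P0 by auto
qed

subsection \<open>The analytic solution of the recurrences\<close>

context
  fixes x :: "'a::comm_ring_1"
begin

unbundle no vec_syntax
unbundle fps_syntax

text \<open>In q-series notation this is (q^(2n+2); q^2)_N at q = \<open>x\<close>.\<close>

definition shifted_poch :: "nat \<Rightarrow> nat \<Rightarrow> 'a" where
  "shifted_poch N n = (\<Prod>j<N. 1 - x ^ (2 * (n + j + 1)))"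

text \<open>Here \<open>K + 1\<close> is k, and \<open>r\<close> exceeds the multiplicity bound
  \<open>s\<close> by one. The term vanishes for \<open>r = 0\<close>; it is applied only with
  \<open>r \<le> K + 1\<close>, where the subtraction does not truncate.\<close>

definition bressoud_term :: "nat \<Rightarrow> nat \<Rightarrow> nat \<Rightarrow> nat \<Rightarrow> 'a" where
  "bressoud_term K r N n = (- 1) ^ n * x ^ (n * (N * K + (K + 1) * n + (K + 1 - r)))
     * (1 - x ^ (r * (N + 2 * n + 1))) * shifted_poch N n"

lemma shifted_poch_Suc: "shifted_poch (Suc N) n = shifted_poch N n * (1 - x ^ (2 * (N + n + 1)))"
  by (simp add: shifted_poch_def add_ac)

text \<open>Splitting off the first factor instead of the last raises \<open>n\<close> by one, which
  is what makes the recurrences telescope.\<close>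

lemma shifted_poch_Suc': "shifted_poch (Suc N) n = (1 - x ^ (2 * Suc n)) * shifted_poch N (Suc n)"
  by (simp add: shifted_poch_def prod.lessThan_Suc_shift del: prod.lessThan_Suc power_Suc mult_Suc_right)

text \<open>Counterpart of the step from \<open>s - 2\<close> to \<open>s\<close>, where
  \<open>s = r + 1\<close> and \<open>d = K - s\<close>. The factor 1 + q^(N+1) of that step is
  absorbed by the normalisation (-q;q)_N. The last summand is the boundary term of the truncated
  series.\<close>

lemma bressoud_term_rec:
  assumes K: "K = r + 1 + d"
  shows "(\<Sum>n<M. bressoud_term K (r + 2) N n) - (\<Sum>n<M. bressoud_term K r N n)
    = x ^ (Suc N * r) * (\<Sum>n<M. bressoud_term K (d + 1) (Suc N) n)
      - (- 1) ^ M * x ^ (M * (N * K + (K + 1) * M + d)) * ((1 - x ^ (2 * M)) * shifted_poch N M)"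
proof -
  \<comment> \<open>The two halves of the difference are matched after a shift of \<open>n\<close>, using
    \<open>shifted_poch_Suc'\<close> for one and \<open>shifted_poch_Suc\<close> for the other; \<open>H\<close> is the resulting telescoping term.\<close>
  define H where "H n = (- 1) ^ n * x ^ (n * (N * K + (K + 1) * n + d))
    * ((1 - x ^ (2 * n)) * shifted_poch N n)" for n
  have step: "bressoud_term K (r + 2) N n - bressoud_term K r N n
    = (H n - H (Suc n)) + x ^ (Suc N * r) * bressoud_term K (d + 1) (Suc N) n" for n
  proof -
    define a where "a = n * (N * K + (K + 1) * n + d)"
    define c where "c = Suc n * (N * K + (K + 1) * Suc n + d)"
    define T where "T = shifted_poch N n"
    define Z where "Z = x ^ (2 * (N + n + 1))"
    have T': "shifted_poch (Suc N) n = T * (1 - Z)"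
      by (simp add: shifted_poch_Suc T_def Z_def)
    have 1: "bressoud_term K (r + 2) N n
        = (- 1) ^ n * x ^ a * (1 - x ^ (r * (N + 2 * n + 1)) * x ^ (2 * n) * Z) * T"
    proof -
      have "(r + 2) * (N + 2 * n + 1) = r * (N + 2 * n + 1) + 2 * n + 2 * (N + n + 1)"
        by (simp add: algebra_simps)
      moreover have "K + 1 - (r + 2) = d" using K by simp
      ultimately show ?thesis
        by (simp only: bressoud_term_def T_def Z_def a_def power_add)
    qed
    have 2: "bressoud_term K r N n
        = (- 1) ^ n * x ^ a * x ^ (2 * n) * (1 - x ^ (r * (N + 2 * n + 1))) * T"
    proof -
      have "n * (N * K + (K + 1) * n + (K + 1 - r)) = a + 2 * n"
        using K by (simp add: a_def algebra_simps)
      then show ?thesis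
        by (simp only: bressoud_term_def T_def power_add mult.assoc)
    qed
    have 3: "x ^ (Suc N * r) * bressoud_term K (d + 1) (Suc N) n
        = (- 1) ^ n * (x ^ a * x ^ (2 * n) * x ^ (r * (N + 2 * n + 1)) - x ^ c) * (T * (1 - Z))"
    proof -
      have e1: "Suc N * r + n * (Suc N * K + (K + 1) * n + (K + 1 - (d + 1)))
          = a + 2 * n + r * (N + 2 * n + 1)"
        using K by (simp add: a_def algebra_simps)
      have e2: "a + 2 * n + r * (N + 2 * n + 1) + (d + 1) * (Suc N + 2 * n + 1) = c"
        using K by (simp add: a_def c_def algebra_simps)
      define e where "e = n * (Suc N * K + (K + 1) * n + (K + 1 - (d + 1)))"
      define v where "v = (d + 1) * (Suc N + 2 * n + 1)"
      have f1: "x ^ (Suc N * r) * x ^ e = x ^ a * x ^ (2 * n) * x ^ (r * (N + 2 * n + 1))"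
        unfolding e_def power_add [symmetric] e1 ..
      have f2: "x ^ a * x ^ (2 * n) * x ^ (r * (N + 2 * n + 1)) * x ^ v = x ^ c"
        unfolding v_def power_add [symmetric] e2 ..
      have "x ^ (Suc N * r) * bressoud_term K (d + 1) (Suc N) n
        = (- 1) ^ n * (x ^ (Suc N * r) * x ^ e) * (1 - x ^ v) * (T * (1 - Z))"
        unfolding bressoud_term_def T' e_def v_def by (simp only: mult_ac)
      then show ?thesis
        unfolding f1 f2 [symmetric] by (simp only: right_diff_distrib mult_1_right mult.assoc)
    qed
    have 4: "H (Suc n) = - ((- 1) ^ n * x ^ c * (T * (1 - Z)))"
      unfolding H_def shifted_poch_Suc' [symmetric] T' c_def by simp
    have 5: "H n = (- 1) ^ n * x ^ a * ((1 - x ^ (2 * n)) * T)"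
      by (simp only: H_def a_def T_def)
    show ?thesis
      unfolding 1 2 3 4 5 by (simp add: algebra_simps)
  qed
  \<comment> \<open>\<open>H 0\<close> is zero because of its factor
    \<open>1 - x ^ (2 * 0)\<close>.\<close>
  have telescope: "(\<Sum>n<M. H n - H (Suc n)) = - H M"
    using sum_lessThan_telescope'[of H M] by (simp add: H_def)
  show ?thesis
    unfolding sum_subtractf [symmetric] step sum.distrib telescope
      sum_distrib_left [symmetric]
    by (simp add: H_def)
qed

text \<open>Counterpart of the case \<open>s = 0\<close>. With Y = x^(N+1) and X = x^(2n) it rests
  on (1 + Y)(1 - Y X) = (1 - Y^2 X) + Y (1 - X): the first summand completes
  \<open>shifted_poch (Suc N) n\<close>, the second gives the telescoping term
  \<open>H n\<close>.\<close>

lemma bressoud_term_rec_1: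
  "(1 + x ^ Suc N) * (\<Sum>n<M. bressoud_term K 1 N n)
    = (\<Sum>n<M. bressoud_term K (Suc K) (Suc N) n)
      - (- 1) ^ M * x ^ (M * (N * K + (K + 1) * M + K) + Suc N) * ((1 - x ^ (2 * M)) * shifted_poch N M)"
proof -
  define H where "H n = (- 1) ^ n * x ^ (n * (N * K + (K + 1) * n + K) + Suc N)
    * ((1 - x ^ (2 * n)) * shifted_poch N n)" for n
  have step: "(1 + x ^ Suc N) * bressoud_term K 1 N n
    = (H n - H (Suc n)) + bressoud_term K (Suc K) (Suc N) n" for n
  proof -
    define a where "a = n * (N * K + (K + 1) * n + K)"
    define c where "c = Suc n * (N * K + (K + 1) * Suc n + K) + Suc N"
    define T where "T = shifted_poch N n"
    define Y where "Y = x ^ Suc N"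
    have Z: "x ^ (2 * (N + n + 1)) = Y * Y * x ^ (2 * n)"
      unfolding Y_def power_add [symmetric] by (rule arg_cong[of _ _ "power x"]) simp
    have T': "shifted_poch (Suc N) n = T * (1 - Y * Y * x ^ (2 * n))"
      by (simp only: shifted_poch_Suc T_def Z)
    have 1: "bressoud_term K 1 N n = (- 1) ^ n * x ^ a * (1 - Y * x ^ (2 * n)) * T"
      by (simp add: bressoud_term_def T_def a_def Y_def flip: power_add power_Suc)
    have 3: "bressoud_term K (Suc K) (Suc N) n
        = (- 1) ^ n * (x ^ a - x ^ c) * (T * (1 - Y * Y * x ^ (2 * n)))"
    proof -
      have e1: "n * (Suc N * K + (K + 1) * n + (K + 1 - Suc K)) = a"
        by (simp add: a_def algebra_simps)
      have e2: "a + Suc K * (Suc N + 2 * n + 1) = c"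
        by (simp add: a_def c_def algebra_simps)
      show ?thesis
        unfolding bressoud_term_def T' e1 e2 [symmetric] power_add [of x a]
        by (simp only: right_diff_distrib mult_1_right mult.assoc)
    qed
    have 4: "H (Suc n) = - ((- 1) ^ n * x ^ c * (T * (1 - Y * Y * x ^ (2 * n))))"
      unfolding H_def shifted_poch_Suc' [symmetric] T' c_def by simp
    have 5: "H n = (- 1) ^ n * x ^ a * Y * ((1 - x ^ (2 * n)) * T)"
      by (simp only: H_def a_def T_def Y_def power_add mult.assoc)
    show ?thesis
      unfolding 1 3 4 5 Y_def [symmetric] by (simp add: algebra_simps)
  qed
  have telescope: "(\<Sum>n<M. H n - H (Suc n)) = - H M"
    using sum_lessThan_telescope'[of H M] by (simp add: H_def)
  show ?thesis
    unfolding sum_distrib_left step sum.distrib telescope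
    by (simp add: H_def)
qed

end

subsection \<open>Recurrences for the generating functions\<close>

definition msets_gf :: "nat multiset set \<Rightarrow> rat fps" where
  "msets_gf S = Abs_fps (\<lambda>n. of_nat (card {A \<in> S. sum_mset A = n}))"

text \<open>Positive elements with sum \<open>n\<close> are at most \<open>n\<close> in number and
  in size. Finiteness is what makes \<open>card\<close> additive in the generating
  functions.\<close>

lemma finite_msets_sum:
  assumes "\<And>A. A \<in> S \<Longrightarrow> 0 \<notin># A"
  shows "finite {A \<in> S. sum_mset A = (n::nat)}"
proof (rule finite_subset)
  show "finite (mset ` {xs. set xs \<subseteq> {..n} \<and> length xs \<le> n})"
    by (intro finite_imageI finite_lists_length_le) simp
  show "{A \<in> S. sum_mset A = n} \<subseteq> mset ` {xs. set xs \<subseteq> {..n} \<and> length xs \<le> n}"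
  proof safe
    fix A assume A: "A \<in> S" "n = sum_mset A"
    obtain xs where xs: "mset xs = A" by (metis ex_mset)
    have "0 \<notin> set xs" using assms[OF A(1)] xs by auto
    then have "length xs \<le> sum_list xs"
      by (induction xs) (auto simp: Suc_le_eq add_less_le_mono intro: less_le_trans)
    moreover have "x \<le> sum_list xs" if "x \<in> set xs" for x
      using that by (intro member_le_sum_list) auto 
    ultimately show "A \<in> mset ` {xs. set xs \<subseteq> {..sum_mset A} \<and> length xs \<le> sum_mset A}"
      using xs by (auto simp flip: sum_mset_sum_list)
  qed
qed

lemma msets_gf_Un:
  assumes "\<And>A. A \<in> S \<union> S' \<Longrightarrow> 0 \<notin># A" "S \<inter> S' = {}"
  shows "msets_gf (S \<union> S') = msets_gf S + msets_gf S'"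
proof (rule fps_ext)
  fix n
  have "{A \<in> S \<union> S'. sum_mset A = n} = {A \<in> S. sum_mset A = n} \<union> {A \<in> S'. sum_mset A = n}"
    by auto
  moreover have "card \<dots> = card {A \<in> S. sum_mset A = n} + card {A \<in> S'. sum_mset A = n}"
    using assms by (intro card_Un_disjoint finite_msets_sum) auto
  ultimately show "msets_gf (S \<union> S') $ n = (msets_gf S + msets_gf S') $ n"
    by (simp add: msets_gf_def)
qed

lemma msets_gf_image:
  "msets_gf ((\<lambda>B. B + replicate_mset t w) ` S) = fps_X ^ (t * w) * msets_gf S"
proof (rule fps_ext)
  fix n
  have "{A \<in> (\<lambda>B. B + replicate_mset t w) ` S. sum_mset A = n}
    = (\<lambda>B. B + replicate_mset t w) ` {B \<in> S. t * w \<le> n \<and> sum_mset B = n - t * w}"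
    by (auto simp: image_iff)
  also have "card \<dots> = card {B \<in> S. t * w \<le> n \<and> sum_mset B = n - t * w}"
    by (intro card_image) (auto simp: inj_on_def)
  finally show "msets_gf ((\<lambda>B. B + replicate_mset t w) ` S) $ n = (fps_X ^ (t * w) * msets_gf S) $ n"
    by (auto simp: msets_gf_def fps_X_power_mult_nth)
qed

section \<open>Classes of partitions described by multiplicities, and their recurrences\<close>

text \<open>
  Partitions are encoded by the multiplicities of their parts. In a partition with
  \<open>count A j + count A (Suc j) \<le> K\<close> for all \<open>j\<close>, the windows of \<open>K\<close> consecutive parts of spread at
  most 1 are exactly the blocks with equality. The summand \<open>N * K\<close> makes the parity condition
  invariant under adding 1 to all parts.
\<close>

definition bressoud_msets :: "nat \<Rightarrow> nat \<Rightarrow> nat \<Rightarrow> nat multiset set" where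
  "bressoud_msets K s N = {A. (\<forall>x\<in>#A. N < x) \<and> (\<forall>j. count A j + count A (Suc j) \<le> K)
     \<and> count A (Suc N) \<le> s
     \<and> (\<forall>j. count A j + count A (Suc j) = K \<longrightarrow>
          even (j * count A j + Suc j * count A (Suc j) + s + N * K))}"

lemma bressoud_msets_zero: "A \<in> bressoud_msets K s N \<Longrightarrow> 0 \<notin># A"
  by (auto simp: bressoud_msets_def)

lemma bressoud_msets_count_0:
  assumes "A \<in> bressoud_msets K s N" "j \<le> N"
  shows "count A j = 0"
  using assms by (force simp: bressoud_msets_def count_eq_zero_iff)

text \<open>Once the \<open>t\<close> copies of \<open>N + 1\<close> are removed, the gap condition
  leaves at most \<open>K - t\<close> copies of \<open>N + 2\<close>. If \<open>t = s - 1\<close>,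
  the extreme value \<open>K - s + 1\<close> would fill the block of \<open>N + 1\<close> and
  \<open>N + 2\<close> with the wrong parity, so both values of \<open>t\<close> give the bound
  \<open>K - s\<close>. The residue is preserved since \<open>s + N * K\<close> and
  \<open>(K - s) + (N + 1) * K\<close> agree modulo 2.\<close>

lemma bressoud_msets_exact:
  assumes s: "s \<le> K" "K > 0" and t: "t = s \<or> Suc t = s"
  shows "{A \<in> bressoud_msets K s N. count A (Suc N) = t}
    = (\<lambda>B. B + replicate_mset t (Suc N)) ` bressoud_msets K (K - s) (Suc N)"
proof (intro equalityI subsetI)
  obtain d where K: "K = s + d" using s le_Suc_ex by blast
  fix A assume "A \<in> {A \<in> bressoud_msets K s N. count A (Suc N) = t}"
  then have A: "A \<in> bressoud_msets K s N" and cA: "count A (Suc N) = t" by auto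
  have sum: "count A j + count A (Suc j) \<le> K" for j
    using A by (auto simp: bressoud_msets_def)
  have ev: "even (j * count A j + Suc j * count A (Suc j) + s + N * K)"
    if "count A j + count A (Suc j) = K" for j
    using A that by (auto simp: bressoud_msets_def)
  define B where "B = filter_mset (\<lambda>x. x \<noteq> Suc N) A"
  have AB: "A = B + replicate_mset t (Suc N)"
    by (rule multiset_eqI) (auto simp: B_def cA)
  have cB: "count B j = (if j \<le> Suc N then 0 else count A j)" for j
    using bressoud_msets_count_0[OF A, of j] by (auto simp: B_def)
  have d: "count B (Suc (Suc N)) \<le> d"
  proof (rule ccontr)
    assume "\<not> ?thesis"
    with sum[of "Suc N"] cA cB K t have *: "count A (Suc (Suc N)) = Suc d" "Suc t = s"
      by auto
    moreover have "count A (Suc N) + count A (Suc (Suc N)) = K"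
      using * cA K by simp
    ultimately have "even (Suc N * t + Suc (Suc N) * Suc d + s + N * K)"
      using ev[of "Suc N"] cA by metis
    moreover have "Suc N * t + Suc (Suc N) * Suc d + s + N * K = Suc (2 * (N * K + t + d + 1))"
      unfolding K *(2)[symmetric] by (simp add: algebra_simps)
    ultimately show False
      by (simp only: even_Suc dvd_triv_left simp_thms)
  qed
  have "B \<in> bressoud_msets K d (Suc N)"
    unfolding bressoud_msets_def
  proof (intro CollectI conjI ballI allI impI)
    fix x assume "x \<in># B"
    then show "Suc N < x" using cB[of x] by (metis not_in_iff not_le)
  next
    fix j show "count B j + count B (Suc j) \<le> K"
      using sum[of j] by (auto simp: cB)
  next
    fix j assume j: "count B j + count B (Suc j) = K"
    \<comment> \<open>Below \<open>N + 1\<close> a full block would be empty, against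
      \<open>K > 0\<close>. At \<open>N + 1\<close> it consists of \<open>K\<close> copies of
      \<open>N + 2\<close>, which forces \<open>s = 0\<close>.\<close>
    consider "j \<le> N" | "j = Suc N" | "j > Suc N" by linarith
    then show "even (j * count B j + Suc j * count B (Suc j) + d + Suc N * K)"
    proof cases
      case 1 then show ?thesis using j cB s by auto
    next
      case 2
      then have "count B (Suc (Suc N)) = K" "s = 0"
        using j cB d K by auto
      then show ?thesis using 2 K cB by auto
    next
      case 3
      then have "even (j * count A j + Suc j * count A (Suc j) + s + N * K)"
        using ev[of j] j cB by auto
      then show ?thesis using cB 3 K by auto
    qed
  qed (use d in simp)
  then show "A \<in> (\<lambda>B. B + replicate_mset t (Suc N)) ` bressoud_msets K (K - s) (Suc N)"
    using AB K by auto
next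
  obtain d where K: "K = s + d" using s le_Suc_ex by blast
  fix A assume "A \<in> (\<lambda>B. B + replicate_mset t (Suc N)) ` bressoud_msets K (K - s) (Suc N)"
  then obtain B where B: "B \<in> bressoud_msets K d (Suc N)" and AB: "A = B + replicate_mset t (Suc N)"
    using K by auto
  have sum: "count B j + count B (Suc j) \<le> K" for j
    using B by (auto simp: bressoud_msets_def)
  have d: "count B (Suc (Suc N)) \<le> d"
    using B by (auto simp: bressoud_msets_def)
  have ev: "even (j * count B j + Suc j * count B (Suc j) + d + Suc N * K)"
    if "count B j + count B (Suc j) = K" for j
    using B that by (auto simp: bressoud_msets_def)
  have cA: "count A j = (if j \<le> N then 0 else if j = Suc N then t else count B j)" for j
    using bressoud_msets_count_0[OF B, of j] by (auto simp: AB)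
  have "A \<in> bressoud_msets K s N"
    unfolding bressoud_msets_def
  proof (intro CollectI conjI ballI allI impI)
    fix x assume "x \<in># A"
    then show "N < x" using cA[of x] by (metis not_in_iff not_le)
  next
    fix j show "count A j + count A (Suc j) \<le> K"
      using sum[of j] d t K by (auto simp: cA)
  next
    show "count A (Suc N) \<le> s" using t by (auto simp: cA)
  next
    fix j assume j: "count A j + count A (Suc j) = K"
    \<comment> \<open>At \<open>j = N\<close> the full block is all copies of \<open>N + 1\<close>,
      so \<open>t = s = K\<close>; at \<open>j = Suc N\<close> it forces \<open>t = s\<close> and
      the maximal number \<open>d\<close> of copies of \<open>N + 2\<close>.\<close>
    consider "j < N" | "j = N" | "j = Suc N" | "j > Suc N" by linarith
    then show "even (j * count A j + Suc j * count A (Suc j) + s + N * K)"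
    proof cases
      case 1 then show ?thesis using j cA s by auto
    next
      case 2
      then have "t = K" "s = K" using j cA t K by auto
      then show ?thesis using 2 cA by auto
    next
      case 3
      then have "t = s" "count B (Suc (Suc N)) = d"
        using j cA[of "Suc N"] cA[of "Suc (Suc N)"] d t K by auto
      moreover have "Suc N * s + Suc (Suc N) * d + s + N * K = 2 * (Suc N * K)"
        using K by (simp add: algebra_simps)
      ultimately show ?thesis using 3 cA by (simp del: mult_Suc)
    next
      case 4
      then have "even (j * count B j + Suc j * count B (Suc j) + d + Suc N * K)"
        using ev[of j] j cA by auto
      then show ?thesis using cA 4 K by auto
    qed
  qed
  then show "A \<in> {A \<in> bressoud_msets K s N. count A (Suc N) = t}"
    using cA by auto
qed

lemma msets_gf_exact:
  assumes "s \<le> K" "K > 0" "t = s \<or> Suc t = s"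
  shows "msets_gf {A \<in> bressoud_msets K s N. count A (Suc N) = t}
    = fps_X ^ (t * Suc N) * msets_gf (bressoud_msets K (K - s) (Suc N))"
  unfolding bressoud_msets_exact[OF assms] by (rule msets_gf_image)

lemma msets_gf_bressoud_0:
  assumes "K > 0"
  shows "msets_gf (bressoud_msets K 0 N) = msets_gf (bressoud_msets K K (Suc N))"
proof -
  have "bressoud_msets K 0 N = {A \<in> bressoud_msets K 0 N. count A (Suc N) = 0}"
    by (auto simp: bressoud_msets_def)
  then show ?thesis
    using msets_gf_exact[of 0 K 0 N] assms by simp
qed

lemma msets_gf_bressoud_1:
  assumes "K > 0"
  shows "msets_gf (bressoud_msets K 1 N)
    = (1 + fps_X ^ Suc N) * msets_gf (bressoud_msets K (K - 1) (Suc N))"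
proof -
  let ?E = "\<lambda>t. {A \<in> bressoud_msets K 1 N. count A (Suc N) = t}"
  have "bressoud_msets K 1 N = ?E 0 \<union> ?E 1"
    by (auto simp: bressoud_msets_def)
  then have "msets_gf (bressoud_msets K 1 N) = msets_gf (?E 0 \<union> ?E 1)"
    by (rule arg_cong)
  also have "\<dots> = msets_gf (?E 0) + msets_gf (?E 1)"
    by (intro msets_gf_Un) (auto dest: bressoud_msets_zero)
  also have "msets_gf (?E 0) = msets_gf (bressoud_msets K (K - 1) (Suc N))"
    using msets_gf_exact[of 1 K 0 N] assms by simp
  also have "msets_gf (?E 1) = fps_X ^ Suc N * msets_gf (bressoud_msets K (K - 1) (Suc N))"
    using msets_gf_exact[of 1 K 1 N] assms by simp
  finally show ?thesis
    by (simp only: distrib_right mult_1_left)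
qed

text \<open>The parity condition sees \<open>s\<close> only modulo 2, so the members with at most
  \<open>s\<close> copies of \<open>N + 1\<close> form the class for \<open>s\<close>. Those with
  \<open>s + 1\<close> or \<open>s + 2\<close> copies leave the same class of remainders.\<close>

lemma msets_gf_bressoud_add_2:
  assumes "s + 2 \<le> K"
  shows "msets_gf (bressoud_msets K (s + 2) N) = msets_gf (bressoud_msets K s N)
    + fps_X ^ (Suc N * (s + 1)) * (1 + fps_X ^ Suc N) * msets_gf (bressoud_msets K (K - (s + 2)) (Suc N))"
proof -
  let ?W = "bressoud_msets K (s + 2) N"
  let ?E = "\<lambda>t. {A \<in> ?W. count A (Suc N) = t}"
  have "bressoud_msets K s N = {A \<in> ?W. count A (Suc N) \<le> s}"
    by (auto simp: bressoud_msets_def)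
  moreover have "?W = {A \<in> ?W. count A (Suc N) \<le> s} \<union> (?E (s + 1) \<union> ?E (s + 2))"
    by (auto simp: bressoud_msets_def)
  moreover have "msets_gf \<dots> = msets_gf {A \<in> ?W. count A (Suc N) \<le> s} + msets_gf (?E (s + 1) \<union> ?E (s + 2))"
    by (intro msets_gf_Un) (auto dest: bressoud_msets_zero)
  moreover have "msets_gf (?E (s + 1) \<union> ?E (s + 2)) = msets_gf (?E (s + 1)) + msets_gf (?E (s + 2))"
    by (intro msets_gf_Un) (auto dest: bressoud_msets_zero)
  moreover have "msets_gf (?E (s + 1)) = fps_X ^ ((s + 1) * Suc N) * msets_gf (bressoud_msets K (K - (s + 2)) (Suc N))"
    using assms by (intro msets_gf_exact) auto
  moreover have "msets_gf (?E (s + 2)) = fps_X ^ ((s + 2) * Suc N) * msets_gf (bressoud_msets K (K - (s + 2)) (Suc N))"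
    using assms by (intro msets_gf_exact) auto
  moreover have "(fps_X :: rat fps) ^ ((s + 2) * Suc N) = fps_X ^ ((s + 1) * Suc N) * fps_X ^ Suc N"
    unfolding power_add [symmetric] by (rule arg_cong[of _ _ "power fps_X"]) simp
  ultimately show ?thesis
    by (simp only: distrib_left distrib_right mult_1_right mult_1_left mult.assoc
        mult.commute [of _ "Suc N"] add.assoc)
qed

lemma msets_gf_bressoud_cong:
  assumes "K > 0"
  shows "fps_cong (Suc N) (msets_gf (bressoud_msets K s N)) 1"
  unfolding fps_cong_iff
proof safe
  fix n assume n: "n < Suc N"
  have "A = {#}" if A: "A \<in> bressoud_msets K s N" "sum_mset A = n" for A
  proof (rule ccontr)
    assume "A \<noteq> {#}"
    then obtain x where x: "x \<in># A" by auto
    then have "x \<le> sum_mset A"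
      by (metis le_add1 multi_member_split sum_mset.add_mset)
    moreover have "N < x" using A x by (auto simp: bressoud_msets_def)
    ultimately show False using A n by auto
  qed
  moreover have "{#} \<in> bressoud_msets K s N"
    using assms by (auto simp: bressoud_msets_def)
  ultimately have "{A \<in> bressoud_msets K s N. sum_mset A = n} = (if n = 0 then {{#}} else {})"
    by (auto split: if_splits) (metis sum_mset.empty less_irrefl)
  then show "msets_gf (bressoud_msets K s N) $ n = 1 $ n"
    by (simp add: msets_gf_def)
qed

subsection \<open>Comparison modulo powers of the variable\<close>

text \<open>This is (q; q)_n, the q-factorial without division by (1 - q)^n.\<close>

definition q_fact :: "'a::comm_ring_1 \<Rightarrow> nat \<Rightarrow> 'a" where
  "q_fact q n = (\<Prod>j<n. 1 - q ^ Suc j)"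

lemma fps_cong_q_fact:
  assumes "m \<le> n" "L > 0"
  shows "fps_cong (L * Suc m) (q_fact (fps_X ^ L) n) (q_fact (fps_X ^ L) m)"
  unfolding q_fact_def power_mult [symmetric]
  using assms by (intro fps_cong_prod_lessThan fps_cong_one_minus_X_power) auto

lemma q_fact_nth_0: "L > 0 \<Longrightarrow> q_fact (fps_X ^ L) n $ 0 = (1 :: 'a :: idom)"
  by (induction n) (auto simp: q_fact_def simp flip: power_mult power_Suc power_add)

text \<open>This identifies the leading term of the series at \<open>N = M\<close> with the
  normalising factor (q;q)_M (-q;q)_M.\<close>

lemma q_fact_square: "(\<Prod>j<N. 1 - (x::'a::comm_ring_1) ^ (2 * Suc j)) = q_fact x N * (\<Prod>j<N. 1 + x ^ Suc j)"
  unfolding q_fact_def prod.distrib [symmetric]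
  by (intro prod.cong refl) (simp only: mult_2 power_add, simp add: algebra_simps)

text \<open>The recurrences express level \<open>N\<close> through level \<open>N + 1\<close>, and
  at level \<open>M\<close> both sides reduce to the normalising factor. Within a level,
  \<open>s\<close> is reached in steps of two from 0 or 1.\<close>

lemma bressoud_cong:
  assumes K: "K > 0" and "N \<le> M"
  shows "\<forall>s\<le>K. fps_cong M
     (q_fact fps_X M * (\<Prod>j<N. 1 + fps_X ^ Suc j) * msets_gf (bressoud_msets K s N))
     (\<Sum>n<M. bressoud_term fps_X K (Suc s) N n)"
  using \<open>N \<le> M\<close>
proof (induction N rule: inc_induct)
  case base
  show ?case
  proof (intro allI impI)
    fix s assume s: "s \<le> K"
    let ?P = "q_fact fps_X M * (\<Prod>j<M. 1 + fps_X ^ Suc j) :: rat fps"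
    \<comment> \<open>For \<open>n > 0\<close> the exponent is at least \<open>M * n * K\<close>,
      hence at least \<open>M\<close>; only the term \<open>n = 0\<close> survives.\<close>
    have "fps_cong M (bressoud_term fps_X K (Suc s) M n) (if n = 0 then ?P else 0)" for n
    proof (cases "n = 0")
      case True
      have "fps_cong M ((1 - fps_X ^ (Suc s * Suc M)) * ?P) (1 * ?P)"
        by (intro fps_cong_mult fps_cong_one_minus_X_power) auto
      moreover have "shifted_poch fps_X M 0 = ?P"
        unfolding shifted_poch_def q_fact_square [symmetric] by simp
      ultimately show ?thesis
        using True by (simp add: bressoud_term_def del: power_Suc)
    next
      case False
      have "M * 1 \<le> M * (n * K)"
        using False K by (intro mult_le_mono) auto
      also have "\<dots> \<le> n * (M * K + (K + 1) * n + (K + 1 - Suc s))"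
        by (simp add: algebra_simps)
      finally show ?thesis
        using False unfolding bressoud_term_def mult.assoc[of _ "1 - _"]
        by (simp add: fps_cong_mult_X_power_0)
    qed
    then have "fps_cong M (\<Sum>n<M. bressoud_term fps_X K (Suc s) M n) (\<Sum>n<M. if n = 0 then ?P else 0)"
      by (intro fps_cong_sum)
    moreover have "fps_cong M (\<Sum>n<M. if n = 0 then ?P else 0) ?P"
      by (cases "M = 0") (auto simp: fps_cong_iff)
    moreover have "fps_cong M (?P * msets_gf (bressoud_msets K s M)) (?P * 1)"
      by (intro fps_cong_mult fps_cong_refl fps_cong_mono[OF msets_gf_bressoud_cong[OF K]]) simp
    ultimately show "fps_cong M (?P * msets_gf (bressoud_msets K s M))
        (\<Sum>n<M. bressoud_term fps_X K (Suc s) M n)"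
      by (simp add: fps_cong_iff)
  qed
next
  case (step N)
  define E where "E = (q_fact fps_X M :: rat fps)"
  define P where "P = (\<Prod>j<N. 1 + fps_X ^ Suc j :: rat fps)"
  define u where "u = (1 + fps_X ^ Suc N :: rat fps)"
  define G where "G s N = msets_gf (bressoud_msets K s N)" for s N
  define S where "S r N = (\<Sum>n<M. bressoud_term (fps_X :: rat fps) K r N n)" for r N
  have P': "(\<Prod>j<Suc N. 1 + fps_X ^ Suc j) = P * u"
    by (simp add: P_def u_def)
  have IH: "fps_cong M (E * (P * u) * G s (Suc N)) (S (Suc s) (Suc N))" if "s \<le> K" for s
    using step.IH that unfolding P' E_def G_def S_def by blast
  \<comment> \<open>With \<open>M_le\<close> this discards the boundary terms of the truncated
    series.\<close>
  have err: "fps_cong M ((- 1) ^ M * fps_X ^ e * h) (0 :: rat fps)" if "M \<le> e" for e h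
    using that by (rule fps_cong_mult_X_power_0)
  have M_le: "M \<le> M * (N * K + (K + 1) * M + d)" for d
    by (cases M) auto
  have "fps_cong M (E * P * G s N) (S (Suc s) N)" if "s \<le> K" for s
    using that
  proof (induction s rule: less_induct)
    case (less s)
    consider "s = 0" | "s = 1" | s' where "s = s' + 2"
      by (metis One_nat_def add_2_eq_Suc' not0_implies_Suc)
    then show ?case
    proof cases
      case 1
      \<comment> \<open>For \<open>s = 0\<close> both sides are compared after multiplication by
        \<open>u\<close>, whose constant coefficient 1 lets it be cancelled.\<close>
      have "fps_cong M (S (Suc K) (Suc N)) (u * S 1 N)"
        unfolding S_def u_def bressoud_term_rec_1
        by (intro fps_cong_sym[OF fps_cong_diff[OF fps_cong_refl err, simplified]] trans_le_add1 M_le)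
      moreover have "u * (E * P * G 0 N) = E * (P * u) * G K (Suc N)"
        unfolding G_def msets_gf_bressoud_0[OF K] by (simp only: mult_ac)
      ultimately have "fps_cong M (u * (E * P * G 0 N)) (u * S 1 N)"
        using IH[of K] by (metis fps_cong_trans le_refl)
      then show ?thesis
        unfolding 1 One_nat_def by (rule fps_cong_cancel) (simp add: u_def)
    next
      case 2
      \<comment> \<open>The case \<open>s = 1\<close> is the general recurrence at
        \<open>r = 0\<close>, where the subtracted series is zero.\<close>
      have "S 2 N - S 0 N = S (K - 1 + 1) (Suc N)
          - (- 1) ^ M * fps_X ^ (M * (N * K + (K + 1) * M + (K - 1))) * ((1 - fps_X ^ (2 * M)) * shifted_poch fps_X N M)"
        using bressoud_term_rec[of K 0 "K - 1" fps_X N M] K by (simp add: S_def numeral_2_eq_2)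
      moreover have "S 0 N = 0"
        by (simp add: S_def bressoud_term_def)
      ultimately have "fps_cong M (S (K - 1 + 1) (Suc N)) (S 2 N)"
        using fps_cong_sym[OF fps_cong_diff[OF fps_cong_refl err[OF M_le[of "K - 1"]]]] by simp
      with IH[of "K - 1"] have "fps_cong M (E * (P * u) * G (K - 1) (Suc N)) (S 2 N)"
        using fps_cong_trans by auto
      then show ?thesis
        unfolding 2 G_def msets_gf_bressoud_1[OF K] u_def by (simp add: mult_ac numeral_2_eq_2)
    next
      case s: 3
      define d where "d = K - s"
      have Kd: "K = s' + 1 + 1 + d" using s less.prems by (simp add: d_def)
      have "S (s' + 1 + 2) N - S (s' + 1) N = fps_X ^ (Suc N * (s' + 1)) * S (d + 1) (Suc N)
          - (- 1) ^ M * fps_X ^ (M * (N * K + (K + 1) * M + d)) * ((1 - fps_X ^ (2 * M)) * shifted_poch fps_X N M)"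
        unfolding S_def by (rule bressoud_term_rec) (rule Kd)
      then have 1: "fps_cong M (S (s' + 1 + 2) N - S (s' + 1) N) (fps_X ^ (Suc N * (s' + 1)) * S (d + 1) (Suc N))"
        using fps_cong_diff[OF fps_cong_refl err[OF M_le[of d]]] by simp
      have 2: "fps_cong M (E * P * G s' N) (S (s' + 1) N)"
        using less.IH[of s'] s less.prems by simp
      have 3: "fps_cong M (fps_X ^ (Suc N * (s' + 1)) * (E * (P * u) * G d (Suc N)))
          (fps_X ^ (Suc N * (s' + 1)) * S (d + 1) (Suc N))"
        using IH[of d] by (intro fps_cong_mult_X_power[where M = M]) (auto simp: d_def)
      \<comment> \<open>The factor \<open>u\<close> of the combinatorial recurrence turns the
        normalisation of level \<open>N\<close> into that of level \<open>Suc N\<close>.\<close>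
      have "E * P * G s N = E * P * G s' N + fps_X ^ (Suc N * (s' + 1)) * (E * (P * u) * G d (Suc N))"
        using s less.prems msets_gf_bressoud_add_2[of s' K N]
        by (simp add: G_def u_def d_def algebra_simps)
      then show ?thesis
        using fps_cong_add[OF 2 fps_cong_trans[OF 3 fps_cong_sym[OF 1]]] s by simp
    qed
  qed
  then show ?case
    by (simp add: E_def P_def G_def S_def)
qed

subsection \<open>The Jacobi triple product\<close>

text \<open>The Pascal rule defines Gaussian binomials over any commutative ring, without
  quotients.\<close>

fun q_binomial :: "'a::comm_ring_1 \<Rightarrow> nat \<Rightarrow> nat \<Rightarrow> 'a" where
  "q_binomial q n 0 = 1"
| "q_binomial q 0 (Suc k) = 0"
| "q_binomial q (Suc n) (Suc k) = q_binomial q n k + q ^ Suc k * q_binomial q n (Suc k)"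

lemma q_binomial_eq_0: "n < k \<Longrightarrow> q_binomial q n k = 0"
  by (induction q n k rule: q_binomial.induct) auto

lemma q_fact_Suc: "q_fact q (Suc n) = q_fact q n * (1 - q ^ Suc n)"
  by (simp add: q_fact_def)

text \<open>After multiplication by the factorials, the two summands of the Pascal rule contribute 1
  - q^k and q^k (1 - q^l), which add up to 1 - q^(k+l).\<close>

lemma q_binomial_q_fact:
  "q_binomial q (k + l) k * q_fact q k * q_fact q l = q_fact q (k + l)"
proof (induction "k + l" arbitrary: k l)
  case 0
  then show ?case by (simp add: q_fact_def)
next
  case (Suc n)
  show ?case
  proof (cases k)
    case 0
    then show ?thesis by (simp add: q_fact_def)
  next
    case k: (Suc k')
    have n: "n = k' + l" using Suc k by simp
    have 1: "q_binomial q n k' * q_fact q k' * q_fact q l = q_fact q n"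
      using Suc.hyps(1)[OF n] n by simp
    have 2: "q_binomial q n k * q_fact q k * q_fact q l = q_fact q n * (1 - q ^ l)"
    proof (cases l)
      case 0
      then show ?thesis using n k by (simp add: q_binomial_eq_0)
    next
      case (Suc l')
      then have "n = k + l'" using n k by simp
      from Suc.hyps(1)[OF this] this show ?thesis
        using Suc by (simp add: q_fact_Suc mult.assoc[symmetric])
    qed
    have "q_binomial q (k + l) k * q_fact q k * q_fact q l
      = (q_binomial q n k' + q ^ k * q_binomial q n k) * q_fact q k * q_fact q l"
      using n k by simp
    also have "\<dots> = (q_binomial q n k' * q_fact q k' * q_fact q l) * (1 - q ^ k)
        + q ^ k * (q_binomial q n k * q_fact q k * q_fact q l)"
      unfolding k q_fact_Suc by (simp only: distrib_left distrib_right mult_ac)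
    also have "\<dots> = q_fact q n * (1 - q ^ (k + l))"
      unfolding 1 2 by (simp add: algebra_simps power_add)
    also have "\<dots> = q_fact q (k + l)"
      using n k by (simp add: q_fact_Suc)
    finally show ?thesis .
  qed
qed

text \<open>The induction splits off the factor \<open>j = 0\<close> and replaces \<open>x\<close>
  by \<open>x * q\<close>. The homogeneous form with \<open>y\<close> avoids negative powers of
  \<open>q\<close> when the product is centred.\<close>

lemma q_binomial_theorem:
  "(\<Prod>j<n. y + x * q ^ j)
    = (\<Sum>k\<le>n. q_binomial q n k * q ^ (k choose 2) * x ^ k * y ^ (n - k))"
proof (induction n arbitrary: x)
  case 0
  then show ?case by (simp add: binomial_eq_0)
next
  case (Suc n)
  define g where "g k = q_binomial q n k * q ^ (k choose 2) * (x * q) ^ k * y ^ (Suc n - k)" for k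
  have "(\<Prod>j<Suc n. y + x * q ^ j) = (y + x) * (\<Prod>j<n. y + (x * q) * q ^ j)"
    by (simp add: prod.lessThan_Suc_shift mult_ac del: prod.lessThan_Suc)
  also have "\<dots> = (y + x) * (\<Sum>k\<le>n. q_binomial q n k * q ^ (k choose 2) * (x * q) ^ k * y ^ (n - k))"
    unfolding Suc ..
  also have "\<dots> = (\<Sum>k\<le>n. g k)
     + (\<Sum>k\<le>n. q_binomial q n k * q ^ (Suc k choose 2) * x ^ Suc k * y ^ (n - k))"
    unfolding distrib_right [of y x]
    unfolding g_def sum_distrib_left
    by (intro arg_cong2[of _ _ _ _ "(+)"] sum.cong)
       (auto simp: Suc_diff_le power_mult_distrib power_add numeral_2_eq_2 mult_ac)
  also have "(\<Sum>k\<le>n. g k) = (\<Sum>k\<le>Suc n. g k)"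
    by (simp add: g_def q_binomial_eq_0)
  also have "\<dots> = y ^ Suc n + (\<Sum>k\<le>n. g (Suc k))"
    by (subst sum.atMost_Suc_shift) (simp add: g_def binomial_eq_0)
  also have "y ^ Suc n + (\<Sum>k\<le>n. g (Suc k))
     + (\<Sum>k\<le>n. q_binomial q n k * q ^ (Suc k choose 2) * x ^ Suc k * y ^ (n - k))
     = y ^ Suc n + (\<Sum>k\<le>n. q_binomial q (Suc n) (Suc k) * q ^ (Suc k choose 2) * x ^ Suc k * y ^ (n - k))"
    unfolding add.assoc sum.distrib [symmetric] g_def
    by (intro arg_cong2[of _ _ _ _ "(+)"] sum.cong refl)
       (simp add: algebra_simps power_mult_distrib del: binomial_Suc_Suc)
  also have "\<dots> = (\<Sum>k\<le>Suc n. q_binomial q (Suc n) k * q ^ (k choose 2) * x ^ k * y ^ (Suc n - k))"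
    by (subst sum.atMost_Suc_shift) (simp add: binomial_eq_0)
  finally show ?case .
qed

text \<open>Up to the invertible factor \<open>?U\<close>, the claim compares products of two
  q-factorials, each of index at least \<open>w\<close>. All these agree with the one of index
  \<open>w\<close> to the stated order.\<close>

lemma fps_cong_q_binomial:
  fixes M :: nat
  assumes L: "L > 0" and "m + l = 2 * M" "w \<le> m" "w \<le> l"
  shows "fps_cong (L * Suc w) (q_fact (fps_X ^ L) M * q_binomial (fps_X ^ L) (2 * M) m) (1 :: 'a :: field fps)"
proof -
  let ?Q = "fps_X ^ L :: 'a fps"
  let ?F = "q_fact ?Q"
  let ?U = "?F m * ?F l"
  have F: "fps_cong (L * Suc w) (?F n) (?F w)" if "w \<le> n" for n
    using that L by (rule fps_cong_q_fact)
  have "?U * (?F M * q_binomial ?Q (2 * M) m) = ?F M * ?F (2 * M)"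
    unfolding assms(2)[symmetric] q_binomial_q_fact[of ?Q m l, symmetric] by (simp only: mult_ac)
  also have "fps_cong (L * Suc w) \<dots> (?F w * ?F w)"
    using assms by (intro fps_cong_mult F) auto
  also have "fps_cong (L * Suc w) (?F w * ?F w) (?U * 1)"
    unfolding mult_1_right using assms by (intro fps_cong_sym[OF fps_cong_mult] F) auto
  finally show ?thesis
    by (rule fps_cong_cancel) (simp add: q_fact_nth_0[OF L])
qed

lemma sum_lessThan_add:
  fixes f :: "nat \<Rightarrow> 'a::comm_monoid_add"
  shows "sum f {..<m + n} = sum f {..<m} + (\<Sum>i<n. f (m + i))"
  by (induction n) (simp_all add: add.assoc)

lemma prod_lessThan_add:
  fixes f :: "nat \<Rightarrow> 'a::comm_monoid_mult"
  shows "prod f {..<m + n} = prod f {..<m} * (\<Prod>i<n. f (m + i))"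
  by (induction n) (simp_all add: mult.assoc)

lemma two_choose_two: "2 * (n choose 2) + n = n * n"
  by (induction n) (auto simp: numeral_2_eq_2)

text \<open>
  This is the \<open>q\<close>-binomial theorem with \<open>2 * M\<close> factors \<open>x ^ (2 * k * M) - x ^ r * x ^ (2 * k * j)\<close>,
  divided by the monomial \<open>(- 1) ^ M * x ^ c\<close> that the factors with \<open>j < M\<close> and \<open>j \<ge> M\<close> split off.
\<close>

lemma finite_triple_product:
  fixes x :: "'a::idom"
  assumes x: "x \<noteq> 0" and r: "r \<le> k"
  shows "(\<Prod>j<M. (1 - x ^ (2 * k * Suc j - r)) * (1 - x ^ (2 * k * j + r)))
    = (\<Sum>n\<le>M. (- 1) ^ n * q_binomial (x ^ (2 * k)) (2 * M) (M - n) * x ^ (n * (k * n + (k - r))))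
      + (\<Sum>n<M. (- 1) ^ Suc n * q_binomial (x ^ (2 * k)) (2 * M) (Suc M + n) * x ^ (Suc n * (k * n + r)))"
    (is "?P = ?S")
proof -
  define Q where "Q = x ^ (2 * k)"
  \<comment> \<open>The first two summands of \<open>c\<close> come from the factors with
    \<open>j < M\<close>, where \<open>x ^ (r + 2 * k * j)\<close> is split off; the last comes from
    the \<open>M\<close> factors \<open>Q ^ M\<close>.\<close>
  define c where "c = M * r + 2 * k * (M choose 2) + 2 * k * M * M"
  define f where "f m = q_binomial Q (2 * M) m * Q ^ (m choose 2) * (- (x ^ r)) ^ m * (Q ^ M) ^ (2 * M - m)" for m
  have Qpow: "Q ^ n = x ^ (2 * k * n)" for n
    by (simp add: Q_def power_mult)
  have pow: "(\<Prod>j<n. x ^ (r + 2 * k * j)) = x ^ (n * r + 2 * k * (n choose 2))" for n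
    by (induction n) (simp_all add: numeral_2_eq_2 algebra_simps flip: power_add)
  have "(\<Prod>j<M. Q ^ M + - (x ^ r) * Q ^ j)
      = (\<Prod>j<M. - 1 * x ^ (r + 2 * k * j) * (1 - x ^ (2 * k * Suc (M - Suc j) - r)))"
  proof (intro prod.cong refl)
    fix j assume "j \<in> {..<M}"
    then obtain l where M: "M = Suc (j + l)" by (auto simp: less_iff_Suc_add)
    have "2 * k * M = r + 2 * k * j + (2 * k * Suc l - r)"
      using r by (simp add: M algebra_simps)
    then have "Q ^ M = x ^ (r + 2 * k * j) * x ^ (2 * k * Suc l - r)"
      unfolding Q_def by (metis power_add power_mult)
    moreover have "M - Suc j = l"
      by (simp add: M)
    ultimately show "Q ^ M + - (x ^ r) * Q ^ j
        = - 1 * x ^ (r + 2 * k * j) * (1 - x ^ (2 * k * Suc (M - Suc j) - r))"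
      by (simp add: Qpow[of j] power_add right_diff_distrib del: mult_Suc_right)
  qed
  also have "\<dots> = (- 1) ^ M * x ^ (M * r + 2 * k * (M choose 2)) * (\<Prod>j<M. 1 - x ^ (2 * k * Suc j - r))"
    unfolding prod.distrib pow
    using prod.nat_diff_reindex[of "\<lambda>j. 1 - x ^ (2 * k * Suc j - r)" M] by simp
  finally have 1: "(\<Prod>j<M. Q ^ M + - (x ^ r) * Q ^ j)
    = (- 1) ^ M * x ^ (M * r + 2 * k * (M choose 2)) * (\<Prod>j<M. 1 - x ^ (2 * k * Suc j - r))" .
  have "(\<Prod>j<M. Q ^ M + - (x ^ r) * Q ^ (M + j)) = (\<Prod>j<M. Q ^ M * (1 - x ^ (2 * k * j + r)))"
    unfolding power_add Qpow by (intro prod.cong refl) (simp add: algebra_simps)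
  then have 2: "(\<Prod>j<M. Q ^ M + - (x ^ r) * Q ^ (M + j)) = x ^ (2 * k * M * M) * (\<Prod>j<M. 1 - x ^ (2 * k * j + r))"
    by (simp add: prod.distrib Q_def power_mult)
  have "(- 1) ^ M * x ^ c * ?P = (\<Prod>j<M + M. Q ^ M + - (x ^ r) * Q ^ j)"
    unfolding prod_lessThan_add 1 2 by (simp add: c_def power_add prod.distrib)
  also have "\<dots> = (\<Sum>m\<le>M + M. f m)"
    unfolding q_binomial_theorem f_def by (simp add: mult_2)
  also have "\<dots> = (\<Sum>m<Suc M. f m) + (\<Sum>n<M. f (Suc M + n))"
    by (simp only: flip: sum_lessThan_add lessThan_Suc_atMost) simp
  \<comment> \<open>Indices are measured from the centre \<open>M\<close>: \<open>M - n\<close> and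
    \<open>Suc M + n\<close> yield the two halves of the bilateral series.\<close>
  also have "(\<Sum>m<Suc M. f m) = (\<Sum>n\<le>M. f (M - n))"
    using sum.nat_diff_reindex[of f "Suc M"] by (simp add: lessThan_Suc_atMost)
  also have "\<dots> = (\<Sum>n\<le>M. (- 1) ^ M * x ^ c * ((- 1) ^ n * q_binomial Q (2 * M) (M - n) * x ^ (n * (k * n + (k - r)))))"
  proof (intro sum.cong refl)
    fix n assume "n \<in> {..M}"
    then obtain l where M: "M = n + l" using le_Suc_ex by auto
    obtain e where k: "k = r + e" using r le_Suc_ex by blast
    have "2 * k * (l choose 2) + r * l + 2 * k * M * (M + n) = c + n * (k * n + (k - r))"
    proof -
      have "k * (2 * (l choose 2) + l) = k * (l * l)" "k * (2 * (M choose 2) + M) = k * (M * M)"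
        unfolding two_choose_two by simp_all
      then show ?thesis
        unfolding c_def M k diff_add_inverse by (simp add: algebra_simps)
    qed
    then have "x ^ (2 * k * (l choose 2)) * x ^ (r * l) * x ^ (2 * k * M * (M + n)) = x ^ c * x ^ (n * (k * n + (k - r)))"
      by (metis power_add)
    moreover have "2 * M - l = M + n"
      by (simp add: M)
    then have "(Q ^ M) ^ (2 * M - l) = x ^ (2 * k * M * (M + n))"
      by (simp only: Qpow power_mult)
    moreover have "(- (x ^ r)) ^ l = (- 1) ^ M * (- 1) ^ n * x ^ (r * l)"
      by (simp add: M power_minus[of "x ^ r"] power_mult power_add)
    ultimately show "f (M - n) = (- 1) ^ M * x ^ c * ((- 1) ^ n * q_binomial Q (2 * M) (M - n) * x ^ (n * (k * n + (k - r))))"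
      using M by (simp add: f_def Qpow[of "l choose 2"] mult_ac)
  qed
  also have "(\<Sum>n<M. f (Suc M + n)) = (\<Sum>n<M. (- 1) ^ M * x ^ c *
      ((- 1) ^ Suc n * q_binomial Q (2 * M) (Suc M + n) * x ^ (Suc n * (k * n + r))))"
  proof (intro sum.cong refl)
    fix n assume "n \<in> {..<M}"
    then obtain l where M: "M = Suc (n + l)" by (auto simp: less_iff_Suc_add)
    define m where "m = Suc M + n"
    have "2 * k * (m choose 2) + r * m + 2 * k * M * l = c + Suc n * (k * n + r)"
    proof -
      have "k * (2 * (m choose 2) + m) = k * (m * m)" "k * (2 * (M choose 2) + M) = k * (M * M)"
        unfolding two_choose_two by simp_all
      then show ?thesis
        unfolding c_def m_def by (simp add: M algebra_simps)
    qed
    then have exponents: "x ^ (2 * k * (m choose 2)) * x ^ (r * m) * x ^ (2 * k * M * l) = x ^ c * x ^ (Suc n * (k * n + r))"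
      by (metis power_add)
    have "2 * M - m = l"
      by (simp add: M m_def)
    then have "(Q ^ M) ^ (2 * M - m) = x ^ (2 * k * M * l)"
      by (simp only: Qpow power_mult)
    moreover have "(- (x ^ r)) ^ m = (- 1) ^ M * (- 1) ^ Suc n * x ^ (r * m)"
      by (simp add: m_def power_minus[of "x ^ r"] power_mult power_add)
    ultimately have "f (Suc M + n) = (- 1) ^ M * (- 1) ^ Suc n * q_binomial Q (2 * M) m
        * (x ^ (2 * k * (m choose 2)) * x ^ (r * m) * x ^ (2 * k * M * l))"
      unfolding m_def [symmetric] f_def Qpow[of "m choose 2"] by (simp only: mult_ac)
    then show "f (Suc M + n) = (- 1) ^ M * x ^ c * ((- 1) ^ Suc n * q_binomial Q (2 * M) (Suc M + n) * x ^ (Suc n * (k * n + r)))"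
      unfolding exponents unfolding m_def by (simp only: mult_ac)
  qed
  finally have "(- 1) ^ M * x ^ c * ?P = (- 1) ^ M * x ^ c * ?S"
    by (simp only: sum_distrib_left distrib_left Q_def)
  then show ?thesis
    using x by simp
qed

text \<open>The factors 1 - q^(2k(j+1)) turn each q-binomial coefficient of the finite identity into
  1 up to the required order. The two halves of the theta series then pair up termwise.\<close>

lemma triple_product_cong:
  assumes r: "r \<le> Suc K"
  shows "fps_cong M
    (\<Prod>j<M. (1 - fps_X ^ (2 * Suc K * Suc j)) * (1 - fps_X ^ (2 * Suc K * Suc j - r)) * (1 - fps_X ^ (2 * Suc K * j + r)))
    (\<Sum>n<M. bressoud_term (fps_X :: 'a::field fps) K r 0 n)"
proof -
  let ?L = "2 * Suc K"
  let ?F = "q_fact (fps_X ^ ?L) M :: 'a fps"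
  let ?B = "q_binomial (fps_X ^ ?L) (2 * M) :: nat \<Rightarrow> 'a fps"
  \<comment> \<open>\<open>a' n\<close> is the exponent that the formula for \<open>a\<close> gives
    at the index -(n+1).\<close>
  define a where "a n = n * (Suc K * n + (Suc K - r))" for n
  define a' where "a' n = Suc n * (Suc K * n + r)" for n
  have FB: "fps_cong M (?F * ?B m * fps_X ^ e) (fps_X ^ e)"
    if "m + l = 2 * M" "w \<le> m" "w \<le> l" "M \<le> e + ?L * Suc w" for m l w e
    using fps_cong_mult_X_power[OF fps_cong_q_binomial[of ?L m l M w], of M e] that
    by (simp add: mult_ac)
  define S where "S = (\<Sum>n<M. (- 1) ^ n * fps_X ^ a n :: 'a fps)"
  define S' where "S' = (\<Sum>n<M. (- 1) ^ Suc n * fps_X ^ a' n :: 'a fps)"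
  have product: "(\<Prod>j<M. (1 - fps_X ^ (?L * Suc j)) * (1 - fps_X ^ (?L * Suc j - r)) * (1 - fps_X ^ (?L * j + r)))
    = (\<Sum>n\<le>M. (- 1) ^ n * (?F * ?B (M - n) * fps_X ^ a n))
      + (\<Sum>n<M. (- 1) ^ Suc n * (?F * ?B (Suc M + n) * fps_X ^ a' n))" (is "?P = ?A + ?A'")
  proof -
    have "?P = ?F * (\<Prod>j<M. (1 - fps_X ^ (?L * Suc j - r)) * (1 - fps_X ^ (?L * j + r)))"
      by (simp only: q_fact_def prod.distrib power_mult mult.assoc)
    also have "\<dots> = ?A + ?A'"
      unfolding finite_triple_product[OF fps_X_neq_zero r] a_def a'_def
      by (simp only: distrib_left sum_distrib_left mult_ac)
    finally show ?thesis .
  qed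
  have "fps_cong M ?A (\<Sum>n\<le>M. (- 1) ^ n * fps_X ^ a n)"
  proof (intro fps_cong_sum fps_cong_mult fps_cong_refl)
    fix n assume "n \<in> {..M}"
    then obtain l where M: "M = n + l" using le_Suc_ex by auto
    have "n \<le> Suc K * n * n" by (cases n) auto
    also have "\<dots> \<le> a n" by (simp add: a_def algebra_simps)
    finally have "M \<le> a n + ?L * Suc l" using M by (simp add: algebra_simps)
    then show "fps_cong M (?F * ?B (M - n) * fps_X ^ a n) (fps_X ^ a n)"
      using M by (intro FB[of _ "M + n" l]) auto
  qed
  moreover have "fps_cong M (\<Sum>n\<le>M. (- 1) ^ n * fps_X ^ a n) S"
  proof -
    have "M \<le> Suc K * M * M" by (cases M) auto
    also have "\<dots> \<le> a M" by (simp add: a_def algebra_simps)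
    finally have "fps_cong M ((- 1) ^ M * fps_X ^ a M * 1) (0 :: 'a fps)"
      by (rule fps_cong_mult_X_power_0)
    from fps_cong_add[OF fps_cong_refl this, of S] show ?thesis
      by (simp only: S_def lessThan_Suc_atMost [symmetric] sum.lessThan_Suc mult_1_right add_0_right)
  qed
  ultimately have A: "fps_cong M ?A S"
    by (rule fps_cong_trans)
  have A': "fps_cong M ?A' S'"
    unfolding S'_def
  proof (intro fps_cong_sum fps_cong_mult fps_cong_refl)
    fix n assume "n \<in> {..<M}"
    then obtain l where M: "M = Suc (n + l)" by (auto simp: less_iff_Suc_add)
    have "n \<le> Suc K * n * n" by (cases n) auto
    also have "\<dots> \<le> a' n" by (simp add: a'_def algebra_simps)
    finally have "M \<le> a' n + ?L * Suc l" using M by (simp add: algebra_simps)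
    then show "fps_cong M (?F * ?B (Suc M + n) * fps_X ^ a' n) (fps_X ^ a' n)"
      using M by (intro FB[of _ l l]) auto
  qed
  have "S + S' = (\<Sum>n<M. bressoud_term (fps_X :: 'a fps) K r 0 n)"
    unfolding S_def S'_def sum.distrib [symmetric]
  proof (intro sum.cong refl)
    fix n
    obtain e where e: "Suc K = r + e" using r le_Suc_ex by blast
    have "a' n = a n + r * (2 * n + 1)"
      unfolding a_def a'_def e by (simp add: algebra_simps)
    then show "(- 1) ^ n * fps_X ^ a n + (- 1) ^ Suc n * fps_X ^ a' n = bressoud_term (fps_X :: 'a fps) K r 0 n"
      by (simp add: bressoud_term_def shifted_poch_def a_def power_add algebra_simps)
  qed
  then show ?thesis
    using fps_cong_add[OF A A'] unfolding product by (simp only:)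
qed

subsection \<open>From lists to multisets\<close>

text \<open>\<open>P\<close> is inherited by earlier entries, so the entries that satisfy it form a
  prefix.\<close>

lemma filter_append_filter_not:
  assumes "sorted_wrt R p" "\<And>x y. R x y \<Longrightarrow> P y \<Longrightarrow> P x"
  shows "p = filter P p @ filter (\<lambda>x. \<not> P x) p"
  using assms(1)
proof (induction p)
  case (Cons a p)
  show ?case
  proof (cases "P a")
    case False
    then have "\<forall>x\<in>set p. \<not> P x" using Cons.prems assms(2) by auto
    then show ?thesis using False by simp
  qed (use Cons in auto)
qed simp

abbreviation block :: "nat \<Rightarrow> nat list \<Rightarrow> nat list" where
  "block j \<equiv> filter (\<lambda>x. x = j \<or> x = Suc j)"

lemma length_block: "length (block j p) = count_list p j + count_list p (Suc j)"
  by (induction p) auto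

lemma sum_list_block: "sum_list (block j p) = j * count_list p j + Suc j * count_list p (Suc j)"
  by (induction p) auto

lemma block_contiguous:
  assumes "sorted_wrt (\<ge>) p"
  obtains u v where "p = u @ block j p @ v"
proof -
  let ?p = "filter (\<lambda>x. \<not> Suc j < x) p"
  have "p = filter (\<lambda>x. Suc j < x) p @ ?p"
    by (rule filter_append_filter_not[OF assms]) auto
  moreover have "?p = filter (\<lambda>x. j \<le> x) ?p @ filter (\<lambda>x. \<not> j \<le> x) ?p"
    using assms by (intro filter_append_filter_not[of "(\<ge>)"] sorted_wrt_filter) auto
  moreover have "filter (\<lambda>x. j \<le> x) ?p = block j p"
    unfolding filter_filter by (rule filter_cong) auto
  ultimately show ?thesis
    by (metis that)
qed

text \<open>By monotonicity every entry of the window lies between its last entry and that entry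
  plus one.\<close>

lemma window_in_block:
  assumes p: "sorted_wrt (\<ge>) p" and t: "t + c < length p" "p ! t - p ! (t + c) \<le> 1"
  obtains u v where "block (p ! (t + c)) p = u @ take (Suc c) (drop t p) @ v"
proof -
  let ?j = "p ! (t + c)"
  let ?w = "take (Suc c) (drop t p)"
  have mono: "p ! b \<le> p ! a" if "a \<le> b" "b < length p" for a b
    using p that by (cases "a = b") (auto simp: sorted_wrt_iff_nth_less)
  have "x = ?j \<or> x = Suc ?j" if x: "x \<in> set ?w" for x
  proof -
    obtain l where "l < length ?w" "x = ?w ! l"
      using x by (metis in_set_conv_nth)
    then have "l \<le> c" "x = p ! (t + l)"
      using t by auto
    then have "?j \<le> x" "x \<le> p ! t"
      using mono[of "t + l" "t + c"] mono[of t "t + l"] t by auto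
    then show ?thesis using t by auto
  qed
  then have "block ?j ?w = ?w"
    by (simp add: filter_id_conv)
  moreover have "p = take t p @ ?w @ drop (Suc c) (drop t p)"
    by (simp only: append_take_drop_id)
  then have "block ?j p = block ?j (take t p) @ block ?j ?w @ block ?j (drop (Suc c) (drop t p))"
    by (metis filter_append)
  ultimately show ?thesis
    using that by simp
qed

lemma block_window:
  assumes p: "sorted_wrt (\<ge>) p" and c: "Suc c \<le> length (block j p)"
  obtains t where "t + c < length p" "p ! t - p ! (t + c) \<le> 1"
    "take (Suc c) (drop t p) = take (Suc c) (block j p)"
proof -
  obtain u v where uv: "p = u @ block j p @ v"
    using block_contiguous[OF p] .
  define w where "w = block j p"
  have p_eq: "p = u @ w @ v" using uv by (simp add: w_def)
  have c: "c < length w" using c by (simp add: w_def)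
  then have "w ! 0 \<in> set w" "w ! c \<in> set w"
    by (auto intro: nth_mem)
  then have "w ! 0 - w ! c \<le> 1"
    by (auto simp: w_def)
  moreover have "p ! length u = w ! 0" "p ! (length u + c) = w ! c"
    using c by (auto simp: p_eq nth_append)
  moreover have "take (Suc c) (drop (length u) p) = take (Suc c) w"
    using c by (simp add: p_eq)
  moreover have "length u + c < length p"
    using c by (simp add: p_eq)
  ultimately show ?thesis
    using that[of "length u"] by (simp add: w_def)
qed

section \<open>Gap and parity conditions in terms of multiplicities\<close>

lemma gap_condition_iff:
  assumes p: "sorted_wrt (\<ge>) p"
  shows "(\<forall>t. t + K < length p \<longrightarrow> 2 \<le> p ! t - p ! (t + K))
    \<longleftrightarrow> (\<forall>j. count_list p j + count_list p (Suc j) \<le> K)"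
proof (intro iffI allI impI)
  fix j assume gap: "\<forall>t. t + K < length p \<longrightarrow> 2 \<le> p ! t - p ! (t + K)"
  show "count_list p j + count_list p (Suc j) \<le> K"
  proof (rule ccontr)
    assume "\<not> ?thesis"
    then have "Suc K \<le> length (block j p)" by (simp add: length_block)
    then obtain t where "t + K < length p" "p ! t - p ! (t + K) \<le> 1"
      using block_window[OF p] by metis
    with gap show False by fastforce
  qed
next
  fix t assume count: "\<forall>j. count_list p j + count_list p (Suc j) \<le> K" and t: "t + K < length p"
  show "2 \<le> p ! t - p ! (t + K)"
  proof (rule ccontr)
    assume "\<not> ?thesis"
    then have "p ! t - p ! (t + K) \<le> 1" by simp
    then obtain u v where "block (p ! (t + K)) p = u @ take (Suc K) (drop t p) @ v"
      using window_in_block[OF p t] by metis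
    then have "length (block (p ! (t + K)) p) = length (u @ take (Suc K) (drop t p) @ v)"
      by simp
    then have "Suc K \<le> length (block (p ! (t + K)) p)"
      using t by simp
    then show False
      using count by (simp add: length_block not_less_eq_eq [symmetric])
  qed
qed

lemma sum_window:
  assumes "t + c < length p"
  shows "(\<Sum>j = t..t + c. p ! j) = sum_list (take (Suc c) (drop t p))"
proof -
  have "(\<Sum>j = t..t + c. p ! j) = (\<Sum>j = 0..c. p ! (j + t))"
    using sum.shift_bounds_cl_nat_ivl[of "(!) p" 0 t c] by (simp add: add.commute)
  also have "\<dots> = (\<Sum>j = 0..<Suc c. take (Suc c) (drop t p) ! j)"
    using assms by (intro sum.cong) (auto simp: add.commute)
  finally show ?thesis
    using assms by (simp add: sum_list_sum_nth)
qed

text \<open>When no block is longer than \<open>Suc c\<close>, a window of \<open>Suc c\<close>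
  entries of spread at most 1 exhausts its block, so both sides test \<open>Q\<close> on the same
  sums.\<close>

lemma parity_condition_iff:
  assumes p: "sorted_wrt (\<ge>) p" and count: "\<forall>j. count_list p j + count_list p (Suc j) \<le> Suc c"
  shows "(\<forall>t. t + c < length p \<longrightarrow> p ! t - p ! (t + c) \<le> 1 \<longrightarrow> Q (\<Sum>j = t..t + c. p ! j))
    \<longleftrightarrow> (\<forall>j. count_list p j + count_list p (Suc j) = Suc c \<longrightarrow>
          Q (j * count_list p j + Suc j * count_list p (Suc j)))"
proof (intro iffI allI impI)
  fix j
  assume Q: "\<forall>t. t + c < length p \<longrightarrow> p ! t - p ! (t + c) \<le> 1 \<longrightarrow> Q (\<Sum>j = t..t + c. p ! j)"
    and "count_list p j + count_list p (Suc j) = Suc c"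
  then have len: "length (block j p) = Suc c" by (simp add: length_block)
  then obtain t where t: "t + c < length p" "p ! t - p ! (t + c) \<le> 1"
    "take (Suc c) (drop t p) = take (Suc c) (block j p)"
    using block_window[OF p, of c j] by auto
  then have "(\<Sum>j = t..t + c. p ! j) = sum_list (block j p)"
    using len by (simp add: sum_window)
  then show "Q (j * count_list p j + Suc j * count_list p (Suc j))"
    using Q t sum_list_block[of j p] by metis
next
  fix t
  assume Q: "\<forall>j. count_list p j + count_list p (Suc j) = Suc c \<longrightarrow>
          Q (j * count_list p j + Suc j * count_list p (Suc j))"
    and t: "t + c < length p" "p ! t - p ! (t + c) \<le> 1"
  define j where "j = p ! (t + c)"
  define w where "w = take (Suc c) (drop t p)"
  obtain u v where uv: "block j p = u @ w @ v"
    using window_in_block[OF p t] unfolding j_def w_def by metis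
  have w: "length w = Suc c" using t by (simp add: w_def)
  moreover have "length (block j p) \<le> Suc c"
    using count by (simp add: length_block)
  ultimately have "block j p = w"
    by (simp add: uv)
  then have "(\<Sum>j = t..t + c. p ! j) = j * count_list p j + Suc j * count_list p (Suc j)"
    unfolding sum_window[OF t(1)] by (simp only: w_def sum_list_block flip: sum_list_block)
  moreover have "count_list p j + count_list p (Suc j) = Suc c"
    using w \<open>block j p = w\<close> by (simp flip: length_block)
  ultimately show "Q (\<Sum>j = t..t + c. p ! j)"
    using Q by metis
qed

lemma mem_bressoud_partitions_iff:
  assumes p: "sorted_wrt (\<ge>) p" and k: "k \<ge> 2" "i \<le> k"
  shows "p \<in> bressoud_partitions k i n
    \<longleftrightarrow> mset p \<in> bressoud_msets (k - 1) (k - i) 0 \<and> sum_mset (mset p) = n"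
proof -
  obtain c where c: "k = Suc (Suc c)" using k(1) by (metis add_2_eq_Suc le_Suc_ex)
  have idx: "t + k - 1 = t + Suc c" "t + k - 2 = t + c" for t
    using c by auto
  \<comment> \<open>Since \<open>i \<le> k\<close>, i + k and k - i have the same parity;
    \<open>0 * (k - 1)\<close> is the summand \<open>N * K\<close> at \<open>N = 0\<close>.\<close>
  have par: "[S = i + k] (mod 2) \<longleftrightarrow> even (S + (k - i) + 0 * (k - 1))" for S
    using k(2) by (auto simp: cong_def mod2_eq_if split: if_splits)
  define count_cond where "count_cond \<longleftrightarrow> (\<forall>j. count_list p j + count_list p (Suc j) \<le> Suc c)"
  have "p \<in> bressoud_partitions k i n \<longleftrightarrow> (\<forall>x\<in>set p. 0 < x) \<and> sum_list p = n \<and> count_cond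
      \<and> count_list p 1 \<le> k - i
      \<and> (\<forall>t. t + c < length p \<longrightarrow> p ! t - p ! (t + c) \<le> 1 \<longrightarrow>
          even ((\<Sum>j = t..t + c. p ! j) + (k - i) + 0 * (k - 1)))"
    unfolding bressoud_partitions_def is_partition_def mem_Collect_eq idx par gap_condition_iff[OF p] count_cond_def
    by (simp only: p simp_thms conj_assoc)
  also have "\<dots> \<longleftrightarrow> (\<forall>x\<in>set p. 0 < x) \<and> sum_list p = n \<and> count_cond \<and> count_list p 1 \<le> k - i
      \<and> (\<forall>j. count_list p j + count_list p (Suc j) = Suc c \<longrightarrow>
          even (j * count_list p j + Suc j * count_list p (Suc j) + (k - i) + 0 * (k - 1)))"
    using parity_condition_iff[OF p, where Q = "\<lambda>S. even (S + (k - i) + 0 * (k - 1))"]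
    by (intro conj_cong refl) (simp only: count_cond_def)
  also have "\<dots> \<longleftrightarrow> mset p \<in> bressoud_msets (k - 1) (k - i) 0 \<and> sum_mset (mset p) = n"
    unfolding bressoud_msets_def count_cond_def
    by (auto simp: c sum_mset_sum_list count_mset)
  finally show ?thesis .
qed

lemma b_eq_card_msets:
  assumes k: "k \<ge> 2" "i \<le> k"
  shows "b k i n = card {A \<in> bressoud_msets (k - 1) (k - i) 0. sum_mset A = n}"
proof -
  have sorted: "sorted_wrt (\<ge>) p" if "p \<in> bressoud_partitions k i n" for p
    using that by (simp add: bressoud_partitions_def is_partition_def)
  have "inj_on mset (bressoud_partitions k i n)"
  proof (rule inj_onI)
    fix p p' assume *: "p \<in> bressoud_partitions k i n" "p' \<in> bressoud_partitions k i n" "mset p = mset p'"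
    have "rev p = sort p'" "rev p' = sort p'"
      using * sorted by (auto intro!: properties_for_sort[symmetric] simp: sorted_wrt_rev)
    then show "p = p'" by (metis rev_is_rev_conv)
  qed
  moreover have "mset ` bressoud_partitions k i n = {A \<in> bressoud_msets (k - 1) (k - i) 0. sum_mset A = n}"
  proof (intro equalityI subsetI)
    fix A assume A: "A \<in> {A \<in> bressoud_msets (k - 1) (k - i) 0. sum_mset A = n}"
    define p where "p = rev (sorted_list_of_multiset A)"
    have "sorted_wrt (\<ge>) p" "mset p = A"
      using sorted_sorted_list_of_multiset[of A] by (simp_all add: p_def sorted_wrt_rev)
    with A show "A \<in> mset ` bressoud_partitions k i n"
      using mem_bressoud_partitions_iff[OF _ k, of p n] by blast
  qed (use mem_bressoud_partitions_iff[OF sorted k] in blast)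
  ultimately show ?thesis
    unfolding b_def by (metis card_image)
qed

theorem theorem7p3:
  fixes k i :: nat
  assumes "k \<ge> 2" and "i \<in> {1..k}"
  shows "(\<Prod>m. (1 - fps_X ^ (2 * k * Suc m))
               * (1 - fps_X ^ (2 * k * Suc m - k + i - 1))
               * (1 - fps_X ^ (2 * k * Suc m - k - i + 1)))
           / (\<Prod>m. 1 - fps_X ^ Suc m)
         = (Abs_fps (\<lambda>n. of_nat (b k i n)) :: rat fps)"
proof -
  define K where "K = k - 1"
  define r where "r = k - i + 1"
  have k: "k = Suc K" "K > 0" and r: "r \<le> Suc K" "r = Suc (k - i)"
    using assms by (auto simp: K_def r_def)
  define T where "T m = (1 - fps_X ^ (2 * k * Suc m)) * (1 - fps_X ^ (2 * k * Suc m - k + i - 1))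
               * (1 - fps_X ^ (2 * k * Suc m - k - i + 1) :: rat fps)" for m
  define G :: "rat fps" where "G = Abs_fps (\<lambda>n. of_nat (b k i n))"
  have T_eq: "T m = (1 - fps_X ^ (2 * Suc K * Suc m)) * (1 - fps_X ^ (2 * Suc K * Suc m - r))
               * (1 - fps_X ^ (2 * Suc K * m + r))" for m
  \<comment> \<open>As \<open>1 \<le> i \<le> k\<close>, none of the subtractions in the exponents
    truncates.\<close>
  proof -
    have "2 * k * Suc m - k + i - 1 = 2 * Suc K * Suc m - r"
      "2 * k * Suc m - k - i + 1 = 2 * Suc K * m + r"
      using assms by (auto simp: r_def k(1)[symmetric])
    then show ?thesis
      unfolding T_def by (simp only: k(1))
  qed
  have T_cong: "fps_cong (Suc m) (T m) 1" for m
  proof -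
    have e: "Suc m \<le> 2 * Suc K * Suc m - r" "Suc m \<le> 2 * Suc K * m + r"
      using r by (auto simp: algebra_simps)
    have "fps_cong (Suc m) (T m) (1 * 1 * 1)"
      unfolding T_eq by (intro fps_cong_mult fps_cong_one_minus_X_power e) (simp add: algebra_simps)
    then show ?thesis by simp
  qed
  have q_cong: "fps_cong (Suc m) (1 - fps_X ^ Suc m :: rat fps) 1" for m
    by (rule fps_cong_one_minus_X_power) simp
  define P :: "rat fps" where "P = (\<Prod>m. 1 - fps_X ^ Suc m)"
  have G: "G = msets_gf (bressoud_msets K (k - i) 0)"
    using assms by (simp add: G_def msets_gf_def b_eq_card_msets K_def)
  have P_cong: "fps_cong M P (q_fact fps_X M)" for M
    unfolding q_fact_def P_def by (rule fps_prodinf_cong(1)[OF q_cong])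
  have "prodinf T = P * G"
  proof (rule fps_eqI_cong)
    fix M
    have "fps_cong M (prodinf T) (\<Prod>m<M. T m)"
      by (rule fps_prodinf_cong[OF T_cong])
    also have "fps_cong M (\<Prod>m<M. T m) (\<Sum>n<M. bressoud_term fps_X K r 0 n)"
      unfolding T_eq by (rule triple_product_cong[OF r(1)])
    also have "fps_cong M \<dots> (q_fact fps_X M * G)"
      by (rule fps_cong_sym) (use bressoud_cong[OF k(2), of 0 M] r in \<open>simp add: G K_def\<close>)
    also have "fps_cong M (q_fact fps_X M * G) (P * G)"
      by (rule fps_cong_mult[OF fps_cong_sym[OF P_cong] fps_cong_refl])
    finally show "fps_cong M (prodinf T) (P * G)" .
  qed
  moreover have "P $ 0 = 1"
    unfolding P_def by (rule fps_prodinf_cong(2)[OF q_cong])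
  then have "P \<noteq> 0" by auto
  ultimately have "prodinf T / P = G"
    by simp
  then show ?thesis
    unfolding T_def P_def G_def .
qed

end
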